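(* Let $\{(z^t,u^t,\lambda^t)\}$ be generated by the SP-ADMM algorithm (described in the context). If $\mathcal F(z^t,u^t,\lambda^t)=0$ for some $t\ge1$, then $(z^t,u^t,\lambda^t)$ is a KKT solution of problem (P), i.e. $$z^t\in\arg\min_{z\in\mathcal X\cap\mathcal Z}\ \sum_{i\in\mathcal N}F_i(z_i,u_i^t)+\langle\lambda_i^t,A_iz_i\rangle,$$ $$0\in\nabla_{u_i}F_i(z_i^t,u_i^t)+\partial\delta_{\mathcal B^{N_i}}(u_i^t),\qquad A_iz_i^t=0\qquad\text{for all } i\in\mathcal N.$$ Moreover, $(p^t,u^t)$ is a critical point of the smooth constrained problem (S), and $p^t$ is a critical point of the original localization problem (O).
   Context: Setting. $\mathcal G=(\mathcal N,\mathcal E)$ is an undirected connected graph, $\mathcal N=\{1,\dots,N\}$, $\mathcal N_i=\{j:(i,j)\in\mathcal E\}$, $N_i=|\mathcal N_i|$. The anchor nodes form the nonempty index set $\mathcal A=\{N-m+1,\dots,N\}$, and the position $a_k\in\mathbb R^n$ of each $k\in\mathcal A$ is known. For $i\in\mathcal N$, $j\in\mathcal N_i$, $d_{i,j}=d_{j,i}\in\mathbb R$ is the given (noisy) range measurement between $i$ and $j$. $\mathrm{vec}(x_j,j\in S)$ denotes the stacked vector. For each $i$: $z_i=(p_i,z_i^-,z_i^+)\in\mathbb R^{(2N_i+1)n}$ with $p_i\in\mathbb R^n$, $z_i^{\pm}=\mathrm{vec}(z_{i,j}^{\pm},j\in\mathcal N_i)$, $z_{i,j}^\pm\in\mathbb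 R^n$; $u_i=\mathrm{vec}(u_{i,j},j\in\mathcal N_i)$ and $\lambda_i=\mathrm{vec}(\lambda_{i,j},j\in\mathcal N_i)$ in $\mathbb R^{N_in}$. Symbols $z,u,\lambda,p$ without node index are the concatenations over $i\in\mathcal N$. $\mathcal B$ is the closed Euclidean unit ball of $\mathbb R^n$, $\mathcal B^{N_i}$ the $N_i$-fold product, $\delta_S$ the indicator function ($0$ on $S$, $+\infty$ off $S$), $\|x\|_M^2=x^TMx$, and $|M|$ is the entrywise absolute value of a matrix. Matrices ($\mathbf 1_{N_i}$ all-ones column, $I$ identity, $O$ zero matrix): $A_i=[\mathbf 1_{N_i},-I_{N_i},O_{N_i}]\otimes I_n$, $Q_i=[\mathbf 1_{N_i},O_{N_i},-I_{N_i}]\otimes I_n$, $D_i=\mathrm{Diag}(d_{i,j},j\in\mathcal N_i)\otimes I_n$; $B_i$ is chosen with $cB_i^TB_i=c|A_i^TA_i|+|Q_i^TQ_i|$; $W_i=Q_i^TQ_i+cA_i^TA_i+cB_i^TB_i=2\,\mathrm{Diag}([(c+1)N_i,\,c\mathbf 1_{N_i}^T,\,\mathbf 1_{N_i}^T])\otimes I_n$. Sets: $\mathcal X=\{z: p_i=a_i\ \forall i\in\mathcal A\}$, $\mathcal Z=\{z: z_{i,j}^+=z_{j,i}^-\ \forall i\in\mathcal N,j\in\mathcal N_i\}$. Problem (O) (original): minimize $\sum_{i\in\mathcal N}\sum_{j\in\mathcal N_i}\frac12(\|p_i-p_j\|-d_{i,j})^2$ over $p\in\mathbb R^{nN}$ subject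 to $p_k=a_k$, $k\in\mathcal A$. A critical point of (O) is a $p$ with $p_j=a_j$ for $j\in\mathcal A$ for which there exist $u_{i,j}\in\partial\|\cdot\|(p_i-p_j)$ ($i\in\mathcal N,j\in\mathcal N_i$) such that $0=\sum_{j\in\mathcal N_i}\big[(p_i-p_j)-d_{i,j}u_{i,j}\big]$ for all $i\in\mathcal N\setminus\mathcal A$. Problem (S): minimize $\sum_{i}\sum_{j\in\mathcal N_i}\big[\frac12\|p_i-p_j\|^2-d_{i,j}u_{i,j}^T(p_i-p_j)\big]$ over $(p,u)$ subject to $u_i\in\mathcal B^{N_i}$ ($i\in\mathcal N$), $p_k=a_k$ ($k\in\mathcal A$). A critical point of (S) is a pair $(p,u)$ with: $0=\sum_{j\in\mathcal N_i}\big(p_i-p_j-d_{i,j}u_{i,j}+p_i-p_j+d_{j,i}u_{j,i}\big)$ for $i\in\mathcal N\setminus\mathcal A$; $0\in-d_{i,j}(p_i-p_j)+\partial\delta_{\mathcal B}(u_{i,j})$ for $i\in\mathcal N,j\in\mathcal N_i$; $p_j=a_j$ for $j\in\mathcal A$. Problem (P): minimize $\sum_{i}[F_i(z_i,u_i)+\delta_{\mathcal B^{N_i}}(u_i)]$ over $(z,u)$ subject to $A_iz_i=0$ ($i\in\mathcal N$), $z\in\mathcal X\cap\mathcal Z$, where $F_i(z_i,u_i)=\frac12\|Q_iz_i\|^2-u_i^TD_iQ_iz_i$. SP-ADMM algorithm. Parameters $c,\rho>0$; initial $z_i^0,u_i^0$ and $\lambda_i^0=0$. For $t=0,1,2,\dots$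 and all $i$: $\tilde z_i^{t+1}=W_i^{-1}(Q_i^TD_iu_i^t-A_i^T\lambda_i^t+cB_i^TB_iz_i^t)$, with $p$-block reset to $\tilde p_i^{t+1}=a_i$ if $i\in\mathcal A$; then $p_i^{t+1}=\tilde p_i^{t+1}$, $(z_{i,j}^-)^{t+1}=\frac{c}{c+1}(\tilde z_{i,j}^-)^{t+1}+\frac1{c+1}(\tilde z_{j,i}^+)^{t+1}$, $(z_{i,j}^+)^{t+1}=\frac1{c+1}(\tilde z_{i,j}^+)^{t+1}+\frac c{c+1}(\tilde z_{j,i}^-)^{t+1}$ for $j\in\mathcal N_i$; $u_i^{t+1}=\mathrm{proj}_{\mathcal B^{N_i}}(u_i^t+\frac1\rho D_iQ_iz_i^{t+1})$; $\lambda_i^{t+1}=\lambda_i^t+cA_iz_i^{t+1}$. Optimality gap ($t\ge1$): $$\mathcal F(z^t,u^t,\lambda^t)=\sum_i\Big[\big\|z_i^t-\mathrm{proj}_{\mathcal X,\mathcal Z}\big(z_i^t-(\nabla_{z_i}F_i(z_i^t,u_i^t)+A_i^T\lambda_i^t)\big)\big\|^2+\|A_iz_i^t\|^2+\|u_i^t-u_i^{t-1}\|^2\Big],$$ where $\mathrm{proj}_{\mathcal X,\mathcal Z}(\cdot)$ of the node-$i$ vector means the $i$-th block of the Euclidean projection of the concatenation (over all nodes) onto $\mathcal X\cap\mathcal Z$.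
   Formalization: The last claim, that p^t is a critical point of (O), is stated only when d_{i,j} ≥ 0 on all edges; for negative d_{i,j} it fails (n=1, one edge, anchor at 0, d=-1, fixed point p_1=1). The KKT and (S) claims are for arbitrary real d_{i,j}. *)

theory Defs
  imports "HOL-Analysis.Analysis" "Graph_Theory.Graph_Theory"
begin

text \<open>A stacked vector \<open>vec (x_j, j \<in> S)\<close> with blocks in \<open>\<real>^n\<close> is a function \<open>x :: 'j \<Rightarrow> real ^ 'n\<close>
  of which only the values on \<open>S\<close> are meaningful, because the length of the stack depends on the
  node.  Its scalar coordinates are the pairs \<open>(j, k) \<in> S \<times> UNIV\<close>.  A matrix is a function of
  a row and a column index; its row and column index sets are supplied where it is used.\<close>

definition binner :: "'j set \<Rightarrow> ('j \<Rightarrow> real ^ 'n) \<Rightarrow> ('j \<Rightarrow> real ^ 'n) \<Rightarrow> real" where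
  "binner S x y = (\<Sum>j\<in>S. x j \<bullet> y j)"

definition bnorm :: "'j set \<Rightarrow> ('j \<Rightarrow> real ^ 'n) \<Rightarrow> real" where
  "bnorm S x = L2_set (\<lambda>j. norm (x j)) S"

definition idmat :: "'r \<Rightarrow> 'r \<Rightarrow> real" where
  "idmat r s = (if r = s then 1 else 0)"

definition tmat :: "('r \<Rightarrow> 's \<Rightarrow> real) \<Rightarrow> 's \<Rightarrow> 'r \<Rightarrow> real" where
  "tmat M s r = M r s"

text \<open>In \<open>mmul K M L\<close>, \<open>K\<close> is the common index set of the columns of \<open>M\<close> and the rows of \<open>L\<close>.\<close>

definition mmul :: "'k set \<Rightarrow> ('r \<Rightarrow> 'k \<Rightarrow> real) \<Rightarrow> ('k \<Rightarrow> 's \<Rightarrow> real) \<Rightarrow> 'r \<Rightarrow> 's \<Rightarrow> real" where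
  "mmul K M L r s = (\<Sum>k\<in>K. M r k * L k s)"

definition kron :: "('r \<Rightarrow> 's \<Rightarrow> real) \<Rightarrow> ('k \<Rightarrow> 'l \<Rightarrow> real) \<Rightarrow> 'r \<times> 'k \<Rightarrow> 's \<times> 'l \<Rightarrow> real" where
  "kron M L = (\<lambda>(r, k) (s, l). M r s * L k l)"

text \<open>\<open>mvec S M x\<close> is the matrix-vector product with the vector stacked over \<open>S\<close>.\<close>

definition mvec ::
  "'s set \<Rightarrow> ('r \<times> 'k \<Rightarrow> 's \<times> 'n \<Rightarrow> real) \<Rightarrow> ('s \<Rightarrow> real ^ 'n) \<Rightarrow> 'r \<Rightarrow> real ^ 'k" where
  "mvec S M x = (\<lambda>r. \<chi> k. \<Sum>(s, l)\<in>S \<times> UNIV. M (r, k) (s, l) * x s $ l)"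

definition minverse :: "'k set \<Rightarrow> ('k \<Rightarrow> 'k \<Rightarrow> real) \<Rightarrow> 'k \<Rightarrow> 'k \<Rightarrow> real" where
  "minverse K M =
    (SOME L. \<forall>r\<in>K. \<forall>s\<in>K. mmul K M L r s = idmat r s \<and> mmul K L M r s = idmat r s)"

text \<open>Euclidean projection of a vector stacked over \<open>S\<close>; for nonempty closed convex \<open>C\<close> that does
  not constrain the values off \<open>S\<close>, it is determined uniquely on \<open>S\<close>.\<close>

definition bproj :: "'j set \<Rightarrow> ('j \<Rightarrow> real ^ 'n) set \<Rightarrow> ('j \<Rightarrow> real ^ 'n) \<Rightarrow> 'j \<Rightarrow> real ^ 'n" where
  "bproj S C x = (SOME y. y \<in> C \<and>
     (\<forall>w\<in>C. bnorm S (\<lambda>j. x j - y j) \<le> bnorm S (\<lambda>j. x j - w j)))"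

text \<open>Gradient of a function of a stacked vector: block \<open>j\<close> is the gradient with respect to the
  \<open>j\<close>-th block, the others being held fixed.\<close>

definition bgrad :: "(('j \<Rightarrow> real ^ 'n) \<Rightarrow> real) \<Rightarrow> ('j \<Rightarrow> real ^ 'n) \<Rightarrow> 'j \<Rightarrow> real ^ 'n" where
  "bgrad f x j = (THE g. GDERIV (\<lambda>v. f (x(j := v))) (x j) :> g)"

definition indic :: "'a set \<Rightarrow> 'a \<Rightarrow> ereal" where
  "indic S x = (if x \<in> S then 0 else \<infinity>)"

definition subdiff :: "('a::real_inner \<Rightarrow> ereal) \<Rightarrow> 'a \<Rightarrow> 'a set" where
  "subdiff f x = {g. \<forall>y. f x + ereal (g \<bullet> (y - x)) \<le> f y}"

definition bsubdiff ::
  "'j set \<Rightarrow> (('j \<Rightarrow> real ^ 'n) \<Rightarrow> ereal) \<Rightarrow> ('j \<Rightarrow> real ^ 'n) \<Rightarrow> ('j \<Rightarrow> real ^ 'n) set" where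
  "bsubdiff S f x = {g. \<forall>y. f x + ereal (binner S g (\<lambda>j. y j - x j)) \<le> f y}"

definition ball_prod :: "'j set \<Rightarrow> ('j \<Rightarrow> real ^ 'n) set" where
  "ball_prod S = {v. \<forall>j\<in>S. v j \<in> cball 0 1}"

definition nbrs :: "nat pair_pre_digraph \<Rightarrow> nat \<Rightarrow> nat set" where
  "nbrs G i = {j. (i, j) \<in> parcs G}"

text \<open>The blocks of \<open>z_i = (p_i, z_i^-, z_i^+)\<close>: \<open>z i P\<close> is \<open>p_i\<close>, while \<open>z i (Minus j)\<close> and
  \<open>z i (Plus j)\<close> are \<open>z_{i,j}^-\<close> and \<open>z_{i,j}^+\<close>.\<close>

datatype slot = P | Minus nat | Plus nat

definition slots :: "nat pair_pre_digraph \<Rightarrow> nat \<Rightarrow> slot set" where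
  "slots G i = insert P (Minus ` nbrs G i \<union> Plus ` nbrs G i)"

text \<open>\<open>block_row v M L\<close> is the matrix \<open>[v, M, L]\<close> with rows indexed by neighbours.\<close>

fun block_row ::
  "(nat \<Rightarrow> real) \<Rightarrow> (nat \<Rightarrow> nat \<Rightarrow> real) \<Rightarrow> (nat \<Rightarrow> nat \<Rightarrow> real) \<Rightarrow> nat \<Rightarrow> slot \<Rightarrow> real" where
  "block_row v M L j P = v j"
| "block_row v M L j (Minus k) = M j k"
| "block_row v M L j (Plus k) = L j k"

text \<open>The entries of \<open>A_i\<close> and \<open>Q_i\<close> do not depend on \<open>i\<close>: the row index set is
  \<open>nbrs G i \<times> UNIV\<close> and the column index set is \<open>slots G i \<times> UNIV\<close>.\<close>

definition Amat :: "nat \<times> 'n \<Rightarrow> slot \<times> 'n \<Rightarrow> real" where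
  "Amat = kron (block_row (\<lambda>_. 1) (\<lambda>j k. - idmat j k) (\<lambda>_ _. 0)) idmat"

definition Qmat :: "nat \<times> 'n \<Rightarrow> slot \<times> 'n \<Rightarrow> real" where
  "Qmat = kron (block_row (\<lambda>_. 1) (\<lambda>_ _. 0) (\<lambda>j k. - idmat j k)) idmat"

definition Dmat :: "(nat \<Rightarrow> nat \<Rightarrow> real) \<Rightarrow> nat \<Rightarrow> nat \<times> 'n \<Rightarrow> nat \<times> 'n \<Rightarrow> real" where
  "Dmat d i = kron (\<lambda>j k. if j = k then d i j else 0) idmat"

definition AtA :: "nat pair_pre_digraph \<Rightarrow> nat \<Rightarrow> slot \<times> 'n::finite \<Rightarrow> slot \<times> 'n \<Rightarrow> real" where
  "AtA G i = mmul (nbrs G i \<times> UNIV) (tmat Amat) Amat"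

definition QtQ :: "nat pair_pre_digraph \<Rightarrow> nat \<Rightarrow> slot \<times> 'n::finite \<Rightarrow> slot \<times> 'n \<Rightarrow> real" where
  "QtQ G i = mmul (nbrs G i \<times> UNIV) (tmat Qmat) Qmat"

text \<open>\<open>B_i\<close> has an arbitrary number \<open>r i\<close> of rows.\<close>

definition BtB ::
  "(nat \<Rightarrow> nat) \<Rightarrow> (nat \<Rightarrow> nat \<Rightarrow> slot \<times> 'n \<Rightarrow> real) \<Rightarrow> nat \<Rightarrow> slot \<times> 'n \<Rightarrow> slot \<times> 'n \<Rightarrow> real" where
  "BtB r B i = mmul {..<r i} (tmat (B i)) (B i)"

definition B_choice ::
  "nat pair_pre_digraph \<Rightarrow> real \<Rightarrow> (nat \<Rightarrow> nat) \<Rightarrow> (nat \<Rightarrow> nat \<Rightarrow> slot \<times> 'n::finite \<Rightarrow> real) \<Rightarrow> bool" where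
  "B_choice G c r B \<longleftrightarrow>
     (\<forall>i\<in>pverts G. \<forall>x\<in>slots G i \<times> UNIV. \<forall>y\<in>slots G i \<times> UNIV.
        c * BtB r B i x y = c * \<bar>AtA G i x y\<bar> + \<bar>QtQ G i x y\<bar>)"

definition Wmat ::
  "nat pair_pre_digraph \<Rightarrow> real \<Rightarrow> (nat \<Rightarrow> nat) \<Rightarrow> (nat \<Rightarrow> nat \<Rightarrow> slot \<times> 'n::finite \<Rightarrow> real)
    \<Rightarrow> nat \<Rightarrow> slot \<times> 'n \<Rightarrow> slot \<times> 'n \<Rightarrow> real" where
  "Wmat G c r B i = (\<lambda>x y. QtQ G i x y + c * AtA G i x y + c * BtB r B i x y)"

abbreviation Az :: "nat pair_pre_digraph \<Rightarrow> nat \<Rightarrow> (slot \<Rightarrow> real ^ 'n) \<Rightarrow> nat \<Rightarrow> real ^ 'n" where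
  "Az G i zi \<equiv> mvec (slots G i) Amat zi"

abbreviation Qz :: "nat pair_pre_digraph \<Rightarrow> nat \<Rightarrow> (slot \<Rightarrow> real ^ 'n) \<Rightarrow> nat \<Rightarrow> real ^ 'n" where
  "Qz G i zi \<equiv> mvec (slots G i) Qmat zi"

abbreviation Atl :: "nat pair_pre_digraph \<Rightarrow> nat \<Rightarrow> (nat \<Rightarrow> real ^ 'n) \<Rightarrow> slot \<Rightarrow> real ^ 'n" where
  "Atl G i li \<equiv> mvec (nbrs G i) (tmat Amat) li"

definition Xset :: "nat set \<Rightarrow> (nat \<Rightarrow> real ^ 'n) \<Rightarrow> (nat \<Rightarrow> slot \<Rightarrow> real ^ 'n) set" where
  "Xset \<A> a = {z. \<forall>i\<in>\<A>. z i P = a i}"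

definition Zset :: "nat pair_pre_digraph \<Rightarrow> (nat \<Rightarrow> slot \<Rightarrow> real ^ 'n) set" where
  "Zset G = {z. \<forall>i\<in>pverts G. \<forall>j\<in>nbrs G i. z i (Plus j) = z j (Minus i)}"

definition Fobj ::
  "nat pair_pre_digraph \<Rightarrow> (nat \<Rightarrow> nat \<Rightarrow> real) \<Rightarrow> nat
    \<Rightarrow> (slot \<Rightarrow> real ^ 'n) \<Rightarrow> (nat \<Rightarrow> real ^ 'n) \<Rightarrow> real" where
  "Fobj G d i zi ui = 1 / 2 * (bnorm (nbrs G i) (Qz G i zi))\<^sup>2
     - binner (nbrs G i) ui (mvec (nbrs G i) (Dmat d i) (Qz G i zi))"

definition z_half ::
  "nat pair_pre_digraph \<Rightarrow> nat set \<Rightarrow> (nat \<Rightarrow> real ^ 'n) \<Rightarrow> (nat \<Rightarrow> nat \<Rightarrow> real) \<Rightarrow> real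
    \<Rightarrow> (nat \<Rightarrow> nat) \<Rightarrow> (nat \<Rightarrow> nat \<Rightarrow> slot \<times> 'n::finite \<Rightarrow> real)
    \<Rightarrow> (nat \<Rightarrow> slot \<Rightarrow> real ^ 'n) \<Rightarrow> (nat \<Rightarrow> nat \<Rightarrow> real ^ 'n) \<Rightarrow> (nat \<Rightarrow> nat \<Rightarrow> real ^ 'n)
    \<Rightarrow> nat \<Rightarrow> slot \<Rightarrow> real ^ 'n" where
  "z_half G \<A> a d c r B z u l i =
    (let w = mvec (slots G i) (minverse (slots G i \<times> UNIV) (Wmat G c r B i))
           (\<lambda>s. mvec (nbrs G i) (tmat Qmat) (mvec (nbrs G i) (Dmat d i) (u i)) s
              - Atl G i (l i) s
              + mvec (slots G i) (\<lambda>x y. c * BtB r B i x y) (z i) s)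
     in if i \<in> \<A> then w(P := a i) else w)"

fun z_mix :: "real \<Rightarrow> (nat \<Rightarrow> slot \<Rightarrow> real ^ 'n) \<Rightarrow> nat \<Rightarrow> slot \<Rightarrow> real ^ 'n" where
  "z_mix c w i P = w i P"
| "z_mix c w i (Minus j) = (c / (c + 1)) *\<^sub>R w i (Minus j) + (1 / (c + 1)) *\<^sub>R w j (Plus i)"
| "z_mix c w i (Plus j) = (1 / (c + 1)) *\<^sub>R w i (Plus j) + (c / (c + 1)) *\<^sub>R w j (Minus i)"

definition sp_admm ::
  "nat pair_pre_digraph \<Rightarrow> nat set \<Rightarrow> (nat \<Rightarrow> real ^ 'n) \<Rightarrow> (nat \<Rightarrow> nat \<Rightarrow> real) \<Rightarrow> real \<Rightarrow> real
    \<Rightarrow> (nat \<Rightarrow> nat) \<Rightarrow> (nat \<Rightarrow> nat \<Rightarrow> slot \<times> 'n::finite \<Rightarrow> real)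
    \<Rightarrow> (nat \<Rightarrow> nat \<Rightarrow> slot \<Rightarrow> real ^ 'n) \<Rightarrow> (nat \<Rightarrow> nat \<Rightarrow> nat \<Rightarrow> real ^ 'n)
    \<Rightarrow> (nat \<Rightarrow> nat \<Rightarrow> nat \<Rightarrow> real ^ 'n) \<Rightarrow> bool" where
  "sp_admm G \<A> a d c \<rho> r B z u l \<longleftrightarrow>
    (\<forall>i\<in>pverts G. \<forall>j\<in>nbrs G i. l 0 i j = 0) \<and>
    (\<forall>t. \<forall>i\<in>pverts G.
       (\<forall>s\<in>slots G i. z (Suc t) i s = z_mix c (z_half G \<A> a d c r B (z t) (u t) (l t)) i s) \<and>
       (\<forall>j\<in>nbrs G i. u (Suc t) i j =
          bproj (nbrs G i) (ball_prod (nbrs G i))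
            (\<lambda>k. u t i k + (1 / \<rho>) *\<^sub>R mvec (nbrs G i) (Dmat d i) (Qz G i (z (Suc t) i)) k) j) \<and>
       (\<forall>j\<in>nbrs G i. l (Suc t) i j = l t i j + c *\<^sub>R Az G i (z (Suc t) i) j))"

text \<open>The concatenation over all nodes is stacked over the pairs \<open>(i, s)\<close> with
  \<open>s \<in> slots G i\<close>.\<close>

definition proj_XZ ::
  "nat pair_pre_digraph \<Rightarrow> nat set \<Rightarrow> (nat \<Rightarrow> real ^ 'n)
    \<Rightarrow> (nat \<Rightarrow> slot \<Rightarrow> real ^ 'n) \<Rightarrow> nat \<Rightarrow> slot \<Rightarrow> real ^ 'n" where
  "proj_XZ G \<A> a z =
    curry (bproj (SIGMA i:pverts G. slots G i) (case_prod ` (Xset \<A> a \<inter> Zset G)) (case_prod z))"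

text \<open>In \<open>opt_gap G \<A> a d z u u' l\<close>, \<open>u'\<close> is the iterate preceding \<open>u\<close>.\<close>

definition opt_gap ::
  "nat pair_pre_digraph \<Rightarrow> nat set \<Rightarrow> (nat \<Rightarrow> real ^ 'n) \<Rightarrow> (nat \<Rightarrow> nat \<Rightarrow> real)
    \<Rightarrow> (nat \<Rightarrow> slot \<Rightarrow> real ^ 'n) \<Rightarrow> (nat \<Rightarrow> nat \<Rightarrow> real ^ 'n) \<Rightarrow> (nat \<Rightarrow> nat \<Rightarrow> real ^ 'n)
    \<Rightarrow> (nat \<Rightarrow> nat \<Rightarrow> real ^ 'n) \<Rightarrow> real" where
  "opt_gap G \<A> a d z u u' l =
    (\<Sum>i\<in>pverts G.
       (bnorm (slots G i) (\<lambda>s. z i s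
          - proj_XZ G \<A> a
              (\<lambda>k q. z k q - (bgrad (\<lambda>y. Fobj G d k y (u k)) (z k) q + Atl G k (l k) q)) i s))\<^sup>2
     + (bnorm (nbrs G i) (Az G i (z i)))\<^sup>2
     + (bnorm (nbrs G i) (\<lambda>j. u i j - u' i j))\<^sup>2)"

definition KKT_P ::
  "nat pair_pre_digraph \<Rightarrow> nat set \<Rightarrow> (nat \<Rightarrow> real ^ 'n) \<Rightarrow> (nat \<Rightarrow> nat \<Rightarrow> real)
    \<Rightarrow> (nat \<Rightarrow> slot \<Rightarrow> real ^ 'n) \<Rightarrow> (nat \<Rightarrow> nat \<Rightarrow> real ^ 'n) \<Rightarrow> (nat \<Rightarrow> nat \<Rightarrow> real ^ 'n)
    \<Rightarrow> bool" where
  "KKT_P G \<A> a d z u l \<longleftrightarrow>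
    is_arg_min (\<lambda>y. \<Sum>i\<in>pverts G. Fobj G d i (y i) (u i) + binner (nbrs G i) (l i) (Az G i (y i)))
      (\<lambda>y. y \<in> Xset \<A> a \<inter> Zset G) z \<and>
    (\<forall>i\<in>pverts G.
       (\<exists>g\<in>bsubdiff (nbrs G i) (indic (ball_prod (nbrs G i))) (u i).
          \<forall>j\<in>nbrs G i. 0 = bgrad (Fobj G d i (z i)) (u i) j + g j) \<and>
       (\<forall>j\<in>nbrs G i. Az G i (z i) j = 0))"

definition critical_S ::
  "nat pair_pre_digraph \<Rightarrow> nat set \<Rightarrow> (nat \<Rightarrow> real ^ 'n) \<Rightarrow> (nat \<Rightarrow> nat \<Rightarrow> real)
    \<Rightarrow> (nat \<Rightarrow> real ^ 'n) \<Rightarrow> (nat \<Rightarrow> nat \<Rightarrow> real ^ 'n) \<Rightarrow> bool" where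
  "critical_S G \<A> a d p u \<longleftrightarrow>
    (\<forall>i\<in>pverts G - \<A>.
       0 = (\<Sum>j\<in>nbrs G i. p i - p j - d i j *\<^sub>R u i j + p i - p j + d j i *\<^sub>R u j i)) \<and>
    (\<forall>i\<in>pverts G. \<forall>j\<in>nbrs G i.
       \<exists>g\<in>subdiff (indic (cball 0 1)) (u i j). 0 = - d i j *\<^sub>R (p i - p j) + g) \<and>
    (\<forall>j\<in>\<A>. p j = a j)"

definition critical_O ::
  "nat pair_pre_digraph \<Rightarrow> nat set \<Rightarrow> (nat \<Rightarrow> real ^ 'n) \<Rightarrow> (nat \<Rightarrow> nat \<Rightarrow> real)
    \<Rightarrow> (nat \<Rightarrow> real ^ 'n) \<Rightarrow> bool" where
  "critical_O G \<A> a d p \<longleftrightarrow>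
    (\<forall>j\<in>\<A>. p j = a j) \<and>
    (\<exists>u. (\<forall>i\<in>pverts G. \<forall>j\<in>nbrs G i. u i j \<in> subdiff (\<lambda>x. ereal (norm x)) (p i - p j)) \<and>
         (\<forall>i\<in>pverts G - \<A>. 0 = (\<Sum>j\<in>nbrs G i. (p i - p j) - d i j *\<^sub>R u i j)))"

end

theory Submission
  imports Defs
begin

text \<open>
  Each of the three kinds of terms of the gap is a squared norm, so all of them vanish.  The first
  says that \<open>z\<close> is fixed by a projected gradient step of the Lagrangian onto the affine set
  \<open>\<X> \<inter> \<Z>\<close>, the second that \<open>A\<^sub>i z\<^sub>i = 0\<close>, and the third that \<open>u\<close> did not change in the
  last step, so that it is fixed by the projected gradient step onto the unit balls which produced it.

  A fixed point of a projected gradient step onto a convex set satisfies the first-order variational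
  inequality there (\<open>bproj_fixed_point\<close>).  For \<open>u\<close> this says that \<open>d\<^sub>i\<^sub>j (p\<^sub>i - p\<^sub>j)\<close> is normal to
  the unit ball at \<open>u\<^sub>i\<^sub>j\<close>.  For \<open>z\<close> it gives minimality, because the Lagrangian is a convex quadratic
  in \<open>z\<close> and exceeds its linearisation by a sum of squares (\<open>Fobj_expansion\<close>).  Together these are
  the KKT conditions (\<open>KKT_P_if_stationary\<close>).

  Along the directions that \<open>\<X> \<inter> \<Z>\<close> allows, the inequality for \<open>z\<close> turns into equations
  (\<open>XZ_stationary\<close>).  With the residuals \<open>v\<^sub>i\<^sub>j = p\<^sub>i - p\<^sub>j - d\<^sub>i\<^sub>j u\<^sub>i\<^sub>j\<close>, the equations on the links read
  \<open>\<lambda>\<^sub>i\<^sub>j = - v\<^sub>j\<^sub>i\<close>, which turns the equation \<open>\<Sum>\<^sub>j (v\<^sub>i\<^sub>j + \<lambda>\<^sub>i\<^sub>j) = 0\<close> for the position \<open>p\<^sub>i\<close> into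
  \<open>\<Sum>\<^sub>j (v\<^sub>i\<^sub>j - v\<^sub>j\<^sub>i) = 0\<close>, the criticality equation of the smooth problem
  (\<open>critical_S_if_stationary\<close>).

  Finally, normality forces \<open>u\<^sub>i\<^sub>j\<close> to maximise \<open>\<langle>\<cdot>, p\<^sub>i - p\<^sub>j\<rangle>\<close> over the ball when \<open>d\<^sub>i\<^sub>j > 0\<close>, that
  is, to be a subgradient of the norm.  The same holds for \<open>- u\<^sub>j\<^sub>i\<close>, and the average of the two is
  a subgradient that satisfies the criticality equation of the original problem
  (\<open>critical_S_imp_critical_O\<close>).
\<close>

section \<open>Fixed points of projections\<close>

lemma bnorm_power2: "(bnorm S x)\<^sup>2 = (\<Sum>j\<in>S. x j \<bullet> x j)"
  by (simp add: bnorm_def L2_set_def sum_nonneg power2_norm_eq_inner)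

lemma bnorm_nonneg: "0 \<le> bnorm S x"
  by (simp add: bnorm_def)

lemma bnorm_le_iff:
  "bnorm S x \<le> bnorm T y \<longleftrightarrow> (\<Sum>j\<in>S. x j \<bullet> x j) \<le> (\<Sum>j\<in>T. y j \<bullet> y j)"
  using power2_le_iff_abs_le[of "bnorm T y" "bnorm S x"] bnorm_nonneg[of S x] bnorm_nonneg[of T y]
  by (simp add: bnorm_power2 flip: bnorm_power2)

lemma bnorm_eq_0_iff: "finite S \<Longrightarrow> bnorm S x = 0 \<longleftrightarrow> (\<forall>j\<in>S. x j = 0)"
  by (simp add: bnorm_def L2_set_eq_0_iff)

text \<open>The iteration determines its vectors only on the blocks that are stacked, whereas \<open>bproj\<close> takes
  a total function; values off \<open>S\<close> do not enter the distances that it compares.\<close>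

lemma bproj_cong:
  assumes "\<And>j. j \<in> S \<Longrightarrow> x j = x' j"
  shows "bproj S C x = bproj S C x'"
proof -
  have "bnorm S (\<lambda>j. x j - y j) = bnorm S (\<lambda>j. x' j - y j)" for y
    using assms by (simp add: bnorm_def L2_set_def)
  then show ?thesis
    by (simp add: bproj_def)
qed

text \<open>The easy half of the characterisation of a projection: expanding \<open>x - w = (x - y) - (w - y)\<close>,
  an obtuse angle at \<open>y\<close> only adds to the distance.  It certifies explicitly guessed projections.\<close>

lemma bnorm_minimal_if_obtuse:
  assumes "binner S (\<lambda>j. x j - y j) (\<lambda>j. w j - y j) \<le> 0"
  shows "bnorm S (\<lambda>j. x j - y j) \<le> bnorm S (\<lambda>j. x j - w j)"
proof -
  have "(\<Sum>j\<in>S. (x j - w j) \<bullet> (x j - w j)) =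
      (\<Sum>j\<in>S. (x j - y j) \<bullet> (x j - y j)) - 2 * binner S (\<lambda>j. x j - y j) (\<lambda>j. w j - y j)
      + (\<Sum>j\<in>S. (w j - y j) \<bullet> (w j - y j))"
    unfolding binner_def sum_distrib_left sum.distrib[symmetric] sum_subtractf[symmetric]
    by (intro sum.cong) (simp_all add: inner_diff_left inner_diff_right inner_commute)
  moreover have "0 \<le> (\<Sum>j\<in>S. (w j - y j) \<bullet> (w j - y j))"
    by (simp add: sum_nonneg)
  ultimately show ?thesis
    using assms by (simp add: bnorm_le_iff)
qed

text \<open>The first-order condition at a fixed point: a small step from \<open>z\<close> towards \<open>w\<close> stays in \<open>C\<close>,
  and it would come closer to \<open>x\<close> if the angle were acute.  Since \<open>bproj\<close> is a choice among the
  closest points, it carries information only if there is one; hence the hypothesis on \<open>y\<close>.  It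
  may be any closest point, as \<open>z\<close> takes over the minimality of the chosen one through their
  agreement on \<open>S\<close>.\<close>

lemma bproj_fixed_point:
  assumes minimizer: "y \<in> C" "\<And>w. w \<in> C \<Longrightarrow> bnorm S (\<lambda>j. x j - y j) \<le> bnorm S (\<lambda>j. x j - w j)"
    and only_S: "\<And>v w. v \<in> C \<Longrightarrow> (\<And>j. j \<in> S \<Longrightarrow> w j = v j) \<Longrightarrow> w \<in> C"
    and convex: "\<And>v w \<tau>. v \<in> C \<Longrightarrow> w \<in> C \<Longrightarrow> 0 \<le> \<tau> \<Longrightarrow> \<tau> \<le> 1 \<Longrightarrow>
      (\<lambda>j. v j + \<tau> *\<^sub>R (w j - v j)) \<in> C"
    and fixed: "\<And>j. j \<in> S \<Longrightarrow> bproj S C x j = z j"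
  shows "z \<in> C"
    and "w \<in> C \<Longrightarrow> binner S (\<lambda>j. x j - z j) (\<lambda>j. w j - z j) \<le> 0"
proof -
  have proj: "bproj S C x \<in> C \<and>
      (\<forall>w\<in>C. bnorm S (\<lambda>j. x j - bproj S C x j) \<le> bnorm S (\<lambda>j. x j - w j))"
    unfolding bproj_def by (rule someI[of _ y]) (use minimizer in blast)
  show z: "z \<in> C"
    by (rule only_S[OF conjunct1[OF proj]]) (simp add: fixed)
  assume w: "w \<in> C"
  let ?I = "binner S (\<lambda>j. x j - z j) (\<lambda>j. w j - z j)"
    and ?H = "\<Sum>j\<in>S. (w j - z j) \<bullet> (w j - z j)"
  have eq: "bnorm S (\<lambda>j. x j - bproj S C x j) = bnorm S (\<lambda>j. x j - z j)"
    using fixed by (simp add: bnorm_def L2_set_def)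
  have bound: "2 * ?I \<le> \<tau> * ?H" if "0 < \<tau>" "\<tau> \<le> 1" for \<tau>
  proof -
    have "(\<lambda>j. z j + \<tau> *\<^sub>R (w j - z j)) \<in> C"
      by (rule convex[OF z w]) (use that in simp_all)
    then have "(\<Sum>j\<in>S. (x j - z j) \<bullet> (x j - z j)) \<le>
        (\<Sum>j\<in>S. (x j - (z j + \<tau> *\<^sub>R (w j - z j))) \<bullet> (x j - (z j + \<tau> *\<^sub>R (w j - z j))))"
      using conjunct2[OF proj] unfolding eq bnorm_le_iff by (rule bspec[rotated])
    also have "\<dots> = (\<Sum>j\<in>S. (x j - z j) \<bullet> (x j - z j)) - 2 * \<tau> * ?I + \<tau> * \<tau> * ?H"
    proof -
      have *: "(a - (b + \<tau> *\<^sub>R e)) \<bullet> (a - (b + \<tau> *\<^sub>R e)) =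
          (a - b) \<bullet> (a - b) - 2 * \<tau> * ((a - b) \<bullet> e) + \<tau> * \<tau> * (e \<bullet> e)"
        for a b e :: "real ^ 'b"
        by (simp add: inner_diff_left inner_diff_right inner_add_left inner_add_right
            inner_commute algebra_simps)
      show ?thesis
        unfolding binner_def sum_distrib_left sum.distrib[symmetric] sum_subtractf[symmetric]
        by (intro sum.cong refl) (rule *)
    qed
    finally have "\<tau> * (2 * ?I) \<le> \<tau> * (\<tau> * ?H)"
      by (simp add: algebra_simps)
    then show ?thesis
      using that(1) by (simp only: mult_le_cancel_left_pos)
  qed
  show "?I \<le> 0"
  proof (rule ccontr)
    assume neg: "\<not> ?I \<le> 0"
    have H: "0 \<le> ?H"
      by (simp add: sum_nonneg)
    \<comment> \<open>small enough that the quadratic term cannot outweigh the linear one;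
      the \<open>+ 1\<close> makes the denominator positive\<close>
    define \<tau> where "\<tau> = min 1 (?I / (?H + 1))"
    have "0 < \<tau>" "\<tau> \<le> 1" "\<tau> \<le> ?I / (?H + 1)"
      using neg H by (auto simp: \<tau>_def)
    then have "\<tau> * (?H + 1) \<le> ?I"
      using H by (simp add: field_simps)
    then show False
      using bound[OF \<open>0 < \<tau>\<close> \<open>\<tau> \<le> 1\<close>] neg \<open>0 < \<tau>\<close> by (simp add: distrib_left)
  qed
qed

text \<open>A point that a step \<open>\<kappa> g\<close> followed by projection leaves unchanged has \<open>g\<close> in its normal
  cone, whatever the positive step length.  The projection exists because it can be taken blockwise.\<close>

lemma bproj_ball_prod_fixed_point:
  fixes u g :: "'j \<Rightarrow> real ^ 'n"
  assumes "0 < \<kappa>" and fixed: "\<And>j. j \<in> S \<Longrightarrow> bproj S (ball_prod S) (\<lambda>k. u k + \<kappa> *\<^sub>R g k) j = u j"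
  shows "u \<in> ball_prod S"
    and "w \<in> ball_prod S \<Longrightarrow> binner S g (\<lambda>j. w j - u j) \<le> 0"
proof -
  let ?x = "\<lambda>k. u k + \<kappa> *\<^sub>R g k"
  let ?y = "\<lambda>k. closest_point (cball 0 1) (?x k)"
  have y: "?y \<in> ball_prod S"
    using closest_point_in_set[of "cball (0::real ^ 'n) 1"] by (auto simp: ball_prod_def)
  have min: "bnorm S (\<lambda>j. ?x j - ?y j) \<le> bnorm S (\<lambda>j. ?x j - w j)" if "w \<in> ball_prod S" for w
    unfolding bnorm_def using that closest_point_le[of "cball 0 1" _ "?x _"]
    by (intro L2_set_mono) (auto simp: ball_prod_def dist_norm)
  have conv: "(\<lambda>j. v j + \<tau> *\<^sub>R (w j - v j)) \<in> ball_prod S"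
    if "v \<in> ball_prod S" "w \<in> ball_prod S" "0 \<le> \<tau>" "\<tau> \<le> 1" for v w :: "'j \<Rightarrow> real ^ 'n" and \<tau>
  proof -
    have "v j + \<tau> *\<^sub>R (w j - v j) \<in> cball 0 1" if "j \<in> S" for j
    proof -
      have "(1 - \<tau>) *\<^sub>R v j + \<tau> *\<^sub>R w j \<in> cball 0 1"
        using \<open>v \<in> _\<close> \<open>w \<in> _\<close> \<open>0 \<le> \<tau>\<close> \<open>\<tau> \<le> 1\<close> that
        by (intro convexD[OF convex_cball]) (simp_all add: ball_prod_def)
      then show ?thesis
        by (simp add: algebra_simps)
    qed
    then show ?thesis
      unfolding ball_prod_def by blast
  qed
  have local: "w \<in> ball_prod S"
    if "v \<in> ball_prod S" "\<And>j. j \<in> S \<Longrightarrow> w j = v j" for v w :: "'j \<Rightarrow> real ^ 'n"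
    using that by (simp add: ball_prod_def)
  show "u \<in> ball_prod S"
    by (rule bproj_fixed_point(1)[OF y]) (fact min local conv fixed)+
  assume "w \<in> ball_prod S"
  have "binner S (\<lambda>j. ?x j - u j) (\<lambda>j. w j - u j) \<le> 0"
    by (rule bproj_fixed_point(2)[OF y]) (fact min local conv fixed \<open>w \<in> ball_prod S\<close>)+
  then have "\<kappa> * binner S g (\<lambda>j. w j - u j) \<le> 0"
    by (simp add: binner_def sum_distrib_left)
  then show "binner S g (\<lambda>j. w j - u j) \<le> 0"
    using \<open>0 < \<kappa>\<close> by (simp add: mult_le_0_iff)
qed

section \<open>The coupling constraint\<close>

lemma pair_graph_nbrs:
  assumes "pair_graph G"
  shows "finite (pverts G)" and "finite (nbrs G i)" and "j \<in> nbrs G i \<Longrightarrow> i \<in> pverts G"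
    and "j \<in> nbrs G i \<Longrightarrow> j \<in> pverts G" and "j \<in> nbrs G i \<longleftrightarrow> i \<in> nbrs G j"
proof -
  interpret pair_graph G by fact
  show fin: "finite (pverts G)"
    by simp
  show V: "j \<in> nbrs G i \<Longrightarrow> i \<in> pverts G" "j \<in> nbrs G i \<Longrightarrow> j \<in> pverts G" for i j
    by (auto simp: nbrs_def dest: in_arcsD1 in_arcsD2)
  show "finite (nbrs G i)"
    using V fin by (meson finite_subset subsetI)
  show "j \<in> nbrs G i \<longleftrightarrow> i \<in> nbrs G j"
    by (auto simp: nbrs_def arcs_symmetric)
qed

lemma sum_slots:
  assumes "finite (nbrs G i)"
  shows "(\<Sum>s\<in>slots G i. f s) = f P + (\<Sum>j\<in>nbrs G i. f (Minus j)) + (\<Sum>j\<in>nbrs G i. f (Plus j))"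
proof -
  have "(\<Sum>s\<in>slots G i. f s) = f P + (\<Sum>s\<in>Minus ` nbrs G i \<union> Plus ` nbrs G i. f s)"
    unfolding slots_def using assms by (intro sum.insert) auto
  also have "(\<Sum>s\<in>Minus ` nbrs G i \<union> Plus ` nbrs G i. f s) =
      (\<Sum>s\<in>Minus ` nbrs G i. f s) + (\<Sum>s\<in>Plus ` nbrs G i. f s)"
    using assms by (intro sum.union_disjoint) auto
  finally show ?thesis
    by (simp add: sum.reindex inj_on_def add.assoc)
qed

text \<open>The set \<open>\<Z>\<close> identifies the slot \<open>Plus j\<close> of node \<open>i\<close> with the slot \<open>Minus i\<close> of node \<open>j\<close>.
  Grouping a sum over all slots by these pairs exhibits \<open>\<X> \<inter> \<Z>\<close> as a product of free,
  fixed and diagonal factors.\<close>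

lemma sum_slots_paired:
  fixes f :: "nat \<Rightarrow> slot \<Rightarrow> real"
  assumes G: "pair_graph G"
  shows "(\<Sum>i\<in>pverts G. \<Sum>s\<in>slots G i. f i s) =
    (\<Sum>i\<in>pverts G. f i P + (\<Sum>j\<in>nbrs G i. f i (Plus j) + f j (Minus i)))"
proof -
  have nbrs: "{j \<in> pverts G. j \<in> nbrs G i} = nbrs G i" "{j \<in> pverts G. i \<in> nbrs G j} = nbrs G i" for i
    using pair_graph_nbrs[OF G] by blast+
  have "(\<Sum>i\<in>pverts G. \<Sum>j\<in>nbrs G i. f i (Minus j)) =
      (\<Sum>i\<in>pverts G. \<Sum>j | j \<in> pverts G \<and> j \<in> nbrs G i. f i (Minus j))"
    using nbrs(1) by simp
  also have "\<dots> = (\<Sum>j\<in>pverts G. \<Sum>i | i \<in> pverts G \<and> j \<in> nbrs G i. f i (Minus j))"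
    using pair_graph_nbrs[OF G] by (intro sum.swap_restrict)
  also have "\<dots> = (\<Sum>j\<in>pverts G. \<Sum>i\<in>nbrs G j. f i (Minus j))"
    using nbrs(2) by simp
  finally show ?thesis
    using pair_graph_nbrs[OF G] by (simp add: sum_slots sum.distrib)
qed

text \<open>The projection onto \<open>\<X> \<inter> \<Z>\<close> sets the anchors and replaces each linked pair by its average.
  The deviations of a pair from its average cancel, and every direction inside \<open>\<Z>\<close> is equal on both
  members of a pair, so the residual is orthogonal to the set; at the anchors the directions vanish, and at the other
  positions the residual does.\<close>

lemma proj_XZ_fixed_point:
  fixes z g :: "nat \<Rightarrow> slot \<Rightarrow> real ^ 'n"
  assumes G: "pair_graph G" and \<A>: "\<A> \<subseteq> pverts G"
    and fixed: "\<And>i s. i \<in> pverts G \<Longrightarrow> s \<in> slots G i \<Longrightarrow>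
      proj_XZ G \<A> a (\<lambda>i s. z i s - g i s) i s = z i s"
  shows "z \<in> Xset \<A> a \<inter> Zset G"
    and "w \<in> Xset \<A> a \<inter> Zset G \<Longrightarrow> 0 \<le> (\<Sum>i\<in>pverts G. binner (slots G i) (g i) (\<lambda>s. w i s - z i s))"
proof -
  note nb = pair_graph_nbrs[OF G]
  let ?K = "Xset \<A> a \<inter> Zset G"
  let ?C = "case_prod ` ?K" and ?S = "SIGMA i:pverts G. slots G i"
  define x where "x = (\<lambda>i s. z i s - g i s)"
  have mem_C: "f \<in> ?C \<longleftrightarrow> curry f \<in> ?K" for f :: "nat \<times> slot \<Rightarrow> real ^ 'n"
    by (metis (no_types, lifting) case_prod_curry curry_case_prod image_iff)
  have fin_slots: "finite (slots G i)" for i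
    using nb by (simp add: slots_def)
  have binner_S: "binner ?S (case_prod v) (case_prod w) = (\<Sum>i\<in>pverts G. \<Sum>s\<in>slots G i. v i s \<bullet> w i s)"
    for v w :: "nat \<Rightarrow> slot \<Rightarrow> real ^ 'n"
    unfolding binner_def using nb fin_slots by (subst sum.Sigma) (auto simp: case_prod_beta)
  define y where "y = (\<lambda>i s. case s of
      P \<Rightarrow> (if i \<in> \<A> then a i else x i P)
    | Minus j \<Rightarrow> (1 / 2) *\<^sub>R (x i (Minus j) + x j (Plus i))
    | Plus j \<Rightarrow> (1 / 2) *\<^sub>R (x i (Plus j) + x j (Minus i)))"
  have yK: "y \<in> ?K"
    by (auto simp: y_def Xset_def Zset_def add.commute)
  then have y: "case_prod y \<in> ?C"
    by simp
  have diff: "(\<lambda>q. case_prod v q - case_prod w q) = case_prod (\<lambda>i s. v i s - w i s)"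
    for v w :: "nat \<Rightarrow> slot \<Rightarrow> real ^ 'n"
    by auto
  have min: "bnorm ?S (\<lambda>q. case_prod x q - case_prod y q) \<le> bnorm ?S (\<lambda>q. case_prod x q - f q)"
    if "f \<in> ?C" for f
  proof -
    have "curry f \<in> ?K" "f = case_prod (curry f)"
      using that unfolding mem_C by simp_all
    then obtain w where w: "w \<in> ?K" "f = case_prod w"
      by blast
    have link: "w j (Minus i) - y j (Minus i) = w i (Plus j) - y i (Plus j)"
      if "i \<in> pverts G" "j \<in> nbrs G i" for i j
      using w(1) yK that by (simp add: Zset_def)
    have cancel: "(x i (Plus j) - y i (Plus j)) \<bullet> h + (x j (Minus i) - y j (Minus i)) \<bullet> h = 0" for i j h
    proof -
      have "x i (Plus j) - y i (Plus j) + (x j (Minus i) - y j (Minus i)) = 0"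
        by (simp add: y_def scaleR_add_right scaleR_half_double flip: scaleR_add_left)
      then show ?thesis
        by (metis inner_add_left inner_zero_left)
    qed
    have anchored: "(x i P - y i P) \<bullet> (w i P - y i P) = 0" for i
      using w(1) by (simp add: y_def Xset_def)
    have "(\<Sum>i\<in>pverts G. \<Sum>s\<in>slots G i. (x i s - y i s) \<bullet> (w i s - y i s)) = 0"
      unfolding sum_slots_paired[OF G] by (simp add: anchored link cancel)
    then have "binner ?S (\<lambda>q. case_prod x q - case_prod y q) (\<lambda>q. case_prod w q - case_prod y q) = 0"
      by (simp only: diff binner_S)
    then show ?thesis
      unfolding w(2) by (intro bnorm_minimal_if_obtuse) simp
  qed
  have local: "f' \<in> ?C"
    if f: "f \<in> ?C" and eq: "\<And>q. q \<in> ?S \<Longrightarrow> f' q = f q" for f f' :: "nat \<times> slot \<Rightarrow> real ^ 'n"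
  proof -
    have "f' (i, P) = f (i, P)" if "i \<in> \<A>" for i
      using that \<A> eq by (auto simp: slots_def)
    moreover have "f' (i, Plus j) = f (i, Plus j)" "f' (j, Minus i) = f (j, Minus i)"
      if "i \<in> pverts G" "j \<in> nbrs G i" for i j
      using that nb(4,5) by (auto intro!: eq simp: slots_def)
    ultimately show ?thesis
      using f unfolding mem_C by (simp add: Xset_def Zset_def)
  qed
  have conv: "(\<lambda>q. f q + \<tau> *\<^sub>R (f' q - f q)) \<in> ?C" if "f \<in> ?C" "f' \<in> ?C"
    for f f' :: "nat \<times> slot \<Rightarrow> real ^ 'n" and \<tau>
    using that unfolding mem_C by (simp add: Xset_def Zset_def)
  have fixed': "bproj ?S ?C (case_prod x) q = case_prod z q" if "q \<in> ?S" for q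
    using that fixed by (auto simp: proj_XZ_def x_def)
  have "case_prod z \<in> ?C"
    by (rule bproj_fixed_point(1)[OF y]) (fact min local fixed' | rule conv; assumption)+
  then show "z \<in> ?K"
    by (simp add: mem_C)
  assume "w \<in> ?K"
  then have w: "case_prod w \<in> ?C"
    by simp
  have "binner ?S (\<lambda>q. case_prod x q - case_prod z q) (\<lambda>q. case_prod w q - case_prod z q) \<le> 0"
    by (rule bproj_fixed_point(2)[OF y]) (fact min local fixed' w | rule conv; assumption)+
  then show "0 \<le> (\<Sum>i\<in>pverts G. binner (slots G i) (g i) (\<lambda>s. w i s - z i s))"
    by (simp only: diff binner_S) (simp add: x_def binner_def sum_negf)
qed

text \<open>The direction space of \<open>\<X> \<inter> \<Z>\<close> is linear, so the inequality can be tested with the descent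
  direction \<open>- h\<close>, where \<open>h\<close> is \<open>g\<close> with the anchor positions set to zero and each linked pair
  replaced by its sum.  Then \<open>\<langle>g, h\<rangle>\<close> is a sum of squares of exactly the vectors that have to
  vanish.\<close>

lemma XZ_stationary:
  fixes z g :: "nat \<Rightarrow> slot \<Rightarrow> real ^ 'n"
  assumes G: "pair_graph G" and z: "z \<in> Xset \<A> a \<inter> Zset G"
    and vi: "\<And>w. w \<in> Xset \<A> a \<inter> Zset G \<Longrightarrow>
      0 \<le> (\<Sum>i\<in>pverts G. binner (slots G i) (g i) (\<lambda>s. w i s - z i s))"
  shows "i \<in> pverts G - \<A> \<Longrightarrow> g i P = 0"
    and "i \<in> pverts G \<Longrightarrow> j \<in> nbrs G i \<Longrightarrow> g i (Plus j) + g j (Minus i) = 0"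
proof -
  note nb = pair_graph_nbrs[OF G]
  define h where "h = (\<lambda>i s. case s of
      P \<Rightarrow> (if i \<in> \<A> then 0 else g i P)
    | Minus j \<Rightarrow> g j (Plus i) + g i (Minus j)
    | Plus j \<Rightarrow> g i (Plus j) + g j (Minus i))"
  have h: "h i P = (if i \<in> \<A> then 0 else g i P)" "h i (Plus j) = g i (Plus j) + g j (Minus i)"
    "h j (Minus i) = g i (Plus j) + g j (Minus i)" for i j
    by (simp_all add: h_def)
  let ?sq = "\<lambda>i. h i P \<bullet> h i P + (\<Sum>j\<in>nbrs G i. h i (Plus j) \<bullet> h i (Plus j))"
  have "(\<lambda>i s. z i s - h i s) \<in> Xset \<A> a \<inter> Zset G"
    using z by (simp add: Xset_def Zset_def h)
  from vi[OF this] have "(\<Sum>i\<in>pverts G. \<Sum>s\<in>slots G i. g i s \<bullet> h i s) \<le> 0"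
    by (simp add: binner_def sum_negf)
  also have "(\<Sum>i\<in>pverts G. \<Sum>s\<in>slots G i. g i s \<bullet> h i s) = (\<Sum>i\<in>pverts G. ?sq i)"
    unfolding sum_slots_paired[OF G]
    by (intro sum.cong arg_cong2[where f = "(+)"]) (simp_all add: h inner_add_left)
  finally have "(\<Sum>i\<in>pverts G. ?sq i) \<le> 0" .
  then have sum0: "(\<Sum>i\<in>pverts G. ?sq i) = 0"
    by (intro antisym sum_nonneg add_nonneg_nonneg) simp_all
  have "\<forall>i\<in>pverts G. ?sq i = 0"
    using sum0 by (subst (asm) sum_nonneg_eq_0_iff) (auto intro!: add_nonneg_nonneg sum_nonneg nb(1))
  then have sq0: "h i P \<bullet> h i P = 0 \<and> (\<Sum>j\<in>nbrs G i. h i (Plus j) \<bullet> h i (Plus j)) = 0"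
    if "i \<in> pverts G" for i
    using that by (subst (asm) add_nonneg_eq_0_iff) (auto intro!: sum_nonneg)
  show "g i P = 0" if "i \<in> pverts G - \<A>"
    using sq0[of i] that by (simp add: h)
  show "g i (Plus j) + g j (Minus i) = 0" if "i \<in> pverts G" "j \<in> nbrs G i"
    using sq0[of i] that nb(2) by (simp add: sum_nonneg_eq_0_iff h)
qed

section \<open>The objective and its gradients\<close>

lemma kron_idmat_mvec:
  assumes "finite S"
  shows "mvec S (kron M idmat) x r = (\<Sum>s\<in>S. M r s *\<^sub>R x s)"
proof -
  have "mvec S (kron M idmat) x r $ k = (\<Sum>s\<in>S. \<Sum>l\<in>UNIV. M r s * idmat k l * x s $ l)" for k
    by (simp add: mvec_def kron_def sum.cartesian_product)
  also have "\<dots> k = (\<Sum>s\<in>S. \<Sum>l\<in>UNIV. if k = l then M r s * x s $ k else 0)" for k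
    by (intro sum.cong refl) (simp add: idmat_def)
  finally show ?thesis
    by (simp add: vec_eq_iff)
qed

lemma tmat_kron_idmat: "tmat (kron M idmat) = kron (tmat M) idmat"
  by (auto simp: tmat_def kron_def idmat_def fun_eq_iff)

text \<open>The matrices \<open>A\<^sub>i\<close>, \<open>Q\<^sub>i\<close> and \<open>D\<^sub>i\<close> have the form \<open>M \<otimes> I\<close>, where the rows of \<open>M\<close> have at
  most two nonzero entries, so their products with vectors are short sums of blocks.\<close>

lemma
  assumes "finite (nbrs G i)"
  shows Az_eq: "j \<in> nbrs G i \<Longrightarrow> Az G i y j = y P - y (Minus j)"
    and Qz_eq: "j \<in> nbrs G i \<Longrightarrow> Qz G i y j = y P - y (Plus j)"
    and Dmat_mvec_eq: "j \<in> nbrs G i \<Longrightarrow> mvec (nbrs G i) (Dmat d i) v j = d i j *\<^sub>R v j"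
    and Atl_P: "Atl G i v P = (\<Sum>j\<in>nbrs G i. v j)"
    and Atl_Minus: "j \<in> nbrs G i \<Longrightarrow> Atl G i v (Minus j) = - v j"
    and Atl_Plus: "Atl G i v (Plus j) = 0"
proof -
  have fin: "finite (slots G i)"
    using assms by (simp add: slots_def)
  note eqs = Amat_def Qmat_def Dmat_def kron_idmat_mvec[OF fin] kron_idmat_mvec[OF assms]
    tmat_kron_idmat sum_slots[OF assms] tmat_def idmat_def sum_negf
  note delta = assms if_distrib[of "\<lambda>y. y *\<^sub>R _"] if_distrib[of uminus]
  show "j \<in> nbrs G i \<Longrightarrow> Az G i y j = y P - y (Minus j)"
    by (simp add: eqs delta cong: if_cong)
  show "j \<in> nbrs G i \<Longrightarrow> Qz G i y j = y P - y (Plus j)"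
    by (simp add: eqs delta cong: if_cong)
  show "j \<in> nbrs G i \<Longrightarrow> mvec (nbrs G i) (Dmat d i) v j = d i j *\<^sub>R v j"
    by (simp add: eqs delta cong: if_cong)
  show "Atl G i v P = (\<Sum>j\<in>nbrs G i. v j)"
    by (simp add: eqs)
  show "j \<in> nbrs G i \<Longrightarrow> Atl G i v (Minus j) = - v j"
    by (simp add: eqs delta cong: if_cong)
  show "Atl G i v (Plus j) = 0"
    by (simp add: eqs)
qed

lemma Fobj_eq:
  assumes "finite (nbrs G i)"
  shows "Fobj G d i y v = (\<Sum>j\<in>nbrs G i. 1 / 2 * ((y P - y (Plus j)) \<bullet> (y P - y (Plus j)))
    - d i j * (v j \<bullet> (y P - y (Plus j))))"
  unfolding Fobj_def bnorm_power2 binner_def sum_distrib_left sum_subtractf[symmetric]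
  by (intro sum.cong) (simp_all add: Qz_eq Dmat_mvec_eq assms)

text \<open>The vector \<open>Q\<^sub>i\<^sup>T (Q\<^sub>i y - D\<^sub>i v)\<close>, written out by slots.\<close>

fun F_zgrad ::
  "nat pair_pre_digraph \<Rightarrow> (nat \<Rightarrow> nat \<Rightarrow> real) \<Rightarrow> nat
    \<Rightarrow> (slot \<Rightarrow> real ^ 'n) \<Rightarrow> (nat \<Rightarrow> real ^ 'n) \<Rightarrow> slot \<Rightarrow> real ^ 'n" where
  "F_zgrad G d i y v P = (\<Sum>j\<in>nbrs G i. y P - y (Plus j) - d i j *\<^sub>R v j)"
| "F_zgrad G d i y v (Minus j) = 0"
| "F_zgrad G d i y v (Plus j) = - (y P - y (Plus j) - d i j *\<^sub>R v j)"

text \<open>The second-order expansion of a quadratic is exact.  This one identity yields both the gradient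
  with respect to each block and, as its last term is nonnegative, convexity.\<close>

lemma Fobj_expansion:
  assumes fin: "finite (nbrs G i)"
  shows "Fobj G d i y v = Fobj G d i x v
    + binner (slots G i) (F_zgrad G d i x v) (\<lambda>s. y s - x s)
    + 1 / 2 * (bnorm (nbrs G i) (\<lambda>j. (y P - x P) - (y (Plus j) - x (Plus j))))\<^sup>2"
proof -
  let ?e = "\<lambda>j. x P - x (Plus j)" and ?h = "\<lambda>j. (y P - x P) - (y (Plus j) - x (Plus j))"
  have expand: "1 / 2 * ((e + h) \<bullet> (e + h)) - k * (b \<bullet> (e + h)) =
      1 / 2 * (e \<bullet> e) - k * (b \<bullet> e) + (e - k *\<^sub>R b) \<bullet> h + 1 / 2 * (h \<bullet> h)"
    for e h b :: "real ^ 'b" and k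
    by (simp add: inner_add_left inner_add_right inner_diff_left inner_commute[of h e] distrib_left)
  have "binner (slots G i) (F_zgrad G d i x v) (\<lambda>s. y s - x s) =
      (\<Sum>j\<in>nbrs G i. (?e j - d i j *\<^sub>R v j) \<bullet> (y P - x P))
      + (\<Sum>j\<in>nbrs G i. - (?e j - d i j *\<^sub>R v j) \<bullet> (y (Plus j) - x (Plus j)))"
    unfolding binner_def sum_slots[OF fin] F_zgrad.simps inner_sum_left by simp
  also have "\<dots> = (\<Sum>j\<in>nbrs G i. (?e j - d i j *\<^sub>R v j) \<bullet> ?h j)"
    unfolding sum.distrib[symmetric]
    by (intro sum.cong refl) (simp only: inner_diff_right inner_minus_left)
  finally have linear: "binner (slots G i) (F_zgrad G d i x v) (\<lambda>s. y s - x s) =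
      (\<Sum>j\<in>nbrs G i. (?e j - d i j *\<^sub>R v j) \<bullet> ?h j)" .
  have "y P - y (Plus j) = ?e j + ?h j" for j
    by simp
  then show ?thesis
    unfolding Fobj_eq[OF fin] bnorm_power2 sum_distrib_left linear sum.distrib[symmetric]
    by (simp only: expand)
qed

text \<open>A gradient can be read off an exact expansion along one block; the remainder has zero
  derivative at the base point.\<close>

lemma bgrad_eqI:
  assumes quadratic: "\<And>v. f (x(j := v)) = f x + g \<bullet> (v - x j) + \<kappa> * ((v - x j) \<bullet> (v - x j))"
  shows "bgrad f x j = g"
proof -
  have deriv: "GDERIV (\<lambda>v. f (x(j := v))) (x j) :> g"
    unfolding quadratic gderiv_def
    by (auto intro!: derivative_eq_intros simp: inner_commute)
  show ?thesis
    unfolding bgrad_def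
  proof (rule the_equality)
    show "GDERIV (\<lambda>v. f (x(j := v))) (x j) :> g"
      by (fact deriv)
    fix g' assume "GDERIV (\<lambda>v. f (x(j := v))) (x j) :> g'"
    then have "(\<lambda>h. h \<bullet> g') = (\<lambda>h. h \<bullet> g)"
      using deriv unfolding gderiv_def by (rule has_derivative_unique)
    then show "g' = g"
      by (metis vector_eq_ldot)
  qed
qed

lemma binner_fun_upd:
  assumes "finite S" "q \<in> S"
  shows "binner S g (\<lambda>s. (x(q := v)) s - x s) = g q \<bullet> (v - x q)"
proof -
  have "binner S g (\<lambda>s. (x(q := v)) s - x s) = (\<Sum>s\<in>S. if s = q then g q \<bullet> (v - x q) else 0)"
    unfolding binner_def by (intro sum.cong) auto
  then show ?thesis
    using assms by simp
qed

lemma bgrad_Fobj_z: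
  assumes fin: "finite (nbrs G i)" and q: "q \<in> slots G i"
  shows "bgrad (\<lambda>y. Fobj G d i y v) x q = F_zgrad G d i x v q"
proof (rule bgrad_eqI)
  fix w
  \<comment> \<open>changing the slot \<open>q\<close> alone by \<open>h\<close> changes row \<open>j\<close> of \<open>Q\<^sub>i x\<close> by the entry of
    \<open>Q\<^sub>i\<close> in column \<open>q\<close> times \<open>h\<close>\<close>
  let ?\<kappa> = "\<lambda>j. block_row (\<lambda>_. 1) (\<lambda>_ _. 0) (\<lambda>j k. - idmat j k) j q"
  let ?y = "x(q := w)"
  have "(?y P - x P) - (?y (Plus j) - x (Plus j)) = ?\<kappa> j *\<^sub>R (w - x q)" for j
    by (cases q) (auto simp: idmat_def)
  then show "Fobj G d i ?y v = Fobj G d i x v + F_zgrad G d i x v q \<bullet> (w - x q)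
      + (1 / 2 * (\<Sum>j\<in>nbrs G i. ?\<kappa> j * ?\<kappa> j)) * ((w - x q) \<bullet> (w - x q))"
    using q by (subst Fobj_expansion[OF fin, of _ _ _ x], subst binner_fun_upd)
      (simp_all add: fin slots_def bnorm_power2 sum_distrib_right mult.assoc del: fun_upd_apply)
qed

lemma bgrad_Fobj_u:
  assumes fin: "finite (nbrs G i)" and j: "j \<in> nbrs G i"
  shows "bgrad (Fobj G d i y) v j = - d i j *\<^sub>R (y P - y (Plus j))"
proof (rule bgrad_eqI[where \<kappa> = 0])
  fix w
  let ?g = "\<lambda>j. - d i j *\<^sub>R (y P - y (Plus j))"
  have "Fobj G d i y (v(j := w)) = Fobj G d i y v + binner (nbrs G i) ?g (\<lambda>k. (v(j := w)) k - v k)"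
    unfolding Fobj_eq[OF fin] binner_def sum.distrib[symmetric]
    by (intro sum.cong) (auto simp: inner_diff_left inner_diff_right inner_commute algebra_simps)
  then show "Fobj G d i y (v(j := w)) = Fobj G d i y v + ?g j \<bullet> (w - v j) + 0 * ((w - v j) \<bullet> (w - v j))"
    using binner_fun_upd[OF fin j, of ?g v w] by simp
qed

section \<open>Critical points\<close>

text \<open>Outside \<open>C\<close> the indicator is infinite, so the subgradient inequality fails at any point of
  \<open>C\<close>; in particular, membership of \<open>v\<close> in \<open>C\<close> is part of what a subgradient asserts.\<close>

lemma mem_subdiff_indic_iff:
  assumes "C \<noteq> {}"
  shows "g \<in> subdiff (indic C) v \<longleftrightarrow> v \<in> C \<and> (\<forall>y\<in>C. g \<bullet> (y - v) \<le> 0)"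
proof (cases "v \<in> C")
  case True
  then show ?thesis
    by (auto simp: subdiff_def indic_def)
next
  case False
  moreover obtain y where "y \<in> C"
    using assms by blast
  ultimately show ?thesis
    by (auto simp: subdiff_def indic_def intro!: exI[of _ y])
qed

text \<open>Of the description of the subdifferential of the norm as the vectors of the unit ball that
  attain the maximum of \<open>\<langle>\<cdot>, e\<rangle>\<close> there, this is the direction that covers \<open>e \<noteq> 0\<close> and \<open>e = 0\<close>
  alike.\<close>

lemma subdiff_norm_memI:
  fixes e g :: "'a::real_inner"
  assumes "norm g \<le> 1" and "norm e \<le> g \<bullet> e"
  shows "g \<in> subdiff (\<lambda>x. ereal (norm x)) e"
proof -
  have "norm e + g \<bullet> (y - e) \<le> norm y" for y
  proof -
    have "g \<bullet> y \<le> norm g * norm y"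
      by (rule norm_cauchy_schwarz)
    also have "\<dots> \<le> 1 * norm y"
      using assms(1) by (intro mult_right_mono) simp_all
    finally show ?thesis
      using assms(2) by (simp add: inner_diff_right)
  qed
  then show ?thesis
    by (simp add: subdiff_def)
qed

lemma inner_sgn_self: "sgn e \<bullet> e = norm (e :: 'a::real_inner)"
  by (cases "e = 0") (simp_all add: sgn_div_norm power2_norm_eq_inner[symmetric] power2_eq_square)

text \<open>If a positive multiple of \<open>e\<close> is normal to the ball at \<open>v\<close>, then \<open>v\<close> maximises \<open>\<langle>\<cdot>, e\<rangle>\<close>
  over the ball.  The test point \<open>sgn e\<close> gives the bound, also for \<open>e = 0\<close>, where \<open>sgn e = 0\<close>.\<close>

lemma norm_le_inner_of_normal:
  fixes e v :: "'a::real_inner"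
  assumes "0 < k" and "(k *\<^sub>R e) \<in> subdiff (indic (cball 0 1)) v"
  shows "norm v \<le> 1" and "norm e \<le> v \<bullet> e"
proof -
  have v: "v \<in> cball 0 1" "\<And>y. y \<in> cball 0 1 \<Longrightarrow> (k *\<^sub>R e) \<bullet> (y - v) \<le> 0"
    using assms(2) by (auto simp: mem_subdiff_indic_iff)
  show "norm v \<le> 1"
    using v(1) by simp
  have "sgn e \<in> cball 0 1"
    by (simp add: norm_sgn)
  then have "k * (e \<bullet> (sgn e - v)) \<le> 0"
    using v(2) by force
  then have "e \<bullet> (sgn e - v) \<le> 0"
    using \<open>0 < k\<close> by (simp add: mult_le_0_iff)
  then show "norm e \<le> v \<bullet> e"
    by (simp add: inner_diff_right inner_sgn_self inner_commute[of e])
qed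

text \<open>The multipliers of the smooth problem need not be antisymmetric where \<open>p\<^sub>i = p\<^sub>j\<close>, and its
  equation at node \<open>i\<close> involves both \<open>u\<^sub>i\<^sub>j\<close> and \<open>u\<^sub>j\<^sub>i\<close>.  Taking half their difference turns that
  equation into twice the one of the original problem.  For \<open>d\<^sub>i\<^sub>j > 0\<close>, both \<open>u\<^sub>i\<^sub>j\<close> and \<open>- u\<^sub>j\<^sub>i\<close>
  are subgradients of the norm, hence so is their average.  For a negative \<open>d\<^sub>i\<^sub>j\<close> and \<open>p\<^sub>i \<noteq> p\<^sub>j\<close>,
  normality would make \<open>u\<^sub>i\<^sub>j\<close> the negative of the gradient of the norm.\<close>

lemma critical_S_imp_critical_O:
  assumes G: "pair_graph G"
    and sym: "\<And>i j. (i, j) \<in> parcs G \<Longrightarrow> d i j = d j i"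
    and nonneg: "\<And>i j. (i, j) \<in> parcs G \<Longrightarrow> 0 \<le> d i j"
    and crit: "critical_S G \<A> a d p u"
  shows "critical_O G \<A> a d p"
  unfolding critical_O_def
proof (intro conjI exI ballI)
  note nb = pair_graph_nbrs[OF G]
  \<comment> \<open>where \<open>d i j = 0\<close>, normality says nothing about \<open>u i j\<close>, but there the equation does not
    see the subgradient either, so any will do\<close>
  define v where "v i j = (if d i j = 0 then sgn (p i - p j) else (1 / 2) *\<^sub>R (u i j - u j i))" for i j
  show "p j = a j" if "j \<in> \<A>" for j
    using crit that by (simp add: critical_S_def)
  have normal: "d i j *\<^sub>R (p i - p j) \<in> subdiff (indic (cball 0 1)) (u i j)" if "j \<in> nbrs G i" for i j
    using crit nb(3)[OF that] that by (auto simp: critical_S_def)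
  show "v i j \<in> subdiff (\<lambda>x. ereal (norm x)) (p i - p j)" if j: "j \<in> nbrs G i" for i j
  proof (cases "d i j = 0")
    case True
    then show ?thesis
      by (intro subdiff_norm_memI) (simp_all add: v_def norm_sgn inner_sgn_self)
  next
    case False
    have ji: "i \<in> nbrs G j" and "d j i = d i j"
      using j nb(5) sym by (auto simp: nbrs_def)
    moreover have "0 < d i j"
      using False nonneg[of i j] j by (simp add: nbrs_def)
    ultimately have ij: "norm (u i j) \<le> 1" "norm (p i - p j) \<le> u i j \<bullet> (p i - p j)"
      and ji: "norm (u j i) \<le> 1" "norm (p j - p i) \<le> u j i \<bullet> (p j - p i)"
      using norm_le_inner_of_normal normal[OF j] normal[OF ji] by metis+
    show ?thesis
    proof (rule subdiff_norm_memI)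
      show "norm (v i j) \<le> 1"
        using False ij(1) ji(1) norm_triangle_ineq4[of "u i j" "u j i"] by (simp add: v_def)
      have "norm (p i - p j) + norm (p i - p j) \<le> u i j \<bullet> (p i - p j) + u j i \<bullet> (p j - p i)"
        using ij(2) ji(2) by (simp add: norm_minus_commute)
      moreover have "v i j \<bullet> (p i - p j) = (u i j \<bullet> (p i - p j) + u j i \<bullet> (p j - p i)) / 2"
        using False by (simp add: v_def inner_diff_left inner_diff_right diff_divide_distrib)
      ultimately show "norm (p i - p j) \<le> v i j \<bullet> (p i - p j)"
        by simp
    qed
  qed
  show "0 = (\<Sum>j\<in>nbrs G i. (p i - p j) - d i j *\<^sub>R v i j)" if i: "i \<in> pverts G - \<A>" for i
  proof -
    have "0 = (\<Sum>j\<in>nbrs G i. p i - p j - d i j *\<^sub>R u i j + p i - p j + d j i *\<^sub>R u j i)"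
      using crit i by (simp add: critical_S_def)
    also have "\<dots> = (\<Sum>j\<in>nbrs G i. 2 *\<^sub>R ((p i - p j) - d i j *\<^sub>R v i j))"
    proof (intro sum.cong refl)
      fix j assume "j \<in> nbrs G i"
      then have "d j i = d i j"
        using sym[of i j] by (simp add: nbrs_def)
      then show "p i - p j - d i j *\<^sub>R u i j + p i - p j + d j i *\<^sub>R u j i =
          2 *\<^sub>R ((p i - p j) - d i j *\<^sub>R v i j)"
        by (simp add: v_def scaleR_2 algebra_simps)
    qed
    finally show ?thesis
      by (simp add: scaleR_sum_right[symmetric])
  qed
qed

text \<open>\<open>A\<^sub>i\<^sup>T \<lambda>\<^sub>i\<close> is the gradient of the linear term \<open>\<langle>\<lambda>\<^sub>i, A\<^sub>i z\<^sub>i\<rangle>\<close> of the Lagrangian.\<close>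

lemma binner_Az_diff:
  assumes fin: "finite (nbrs G i)"
  shows "binner (nbrs G i) v (Az G i y) - binner (nbrs G i) v (Az G i x) =
    binner (slots G i) (Atl G i v) (\<lambda>s. y s - x s)"
proof -
  have Az: "binner (nbrs G i) v (Az G i y) = (\<Sum>j\<in>nbrs G i. v j \<bullet> (y P - y (Minus j)))" for y
    unfolding binner_def by (intro sum.cong refl) (simp add: Az_eq fin)
  have "(\<Sum>j\<in>nbrs G i. Atl G i v (Minus j) \<bullet> (y (Minus j) - x (Minus j))) =
      (\<Sum>j\<in>nbrs G i. - v j \<bullet> (y (Minus j) - x (Minus j)))"
    by (intro sum.cong refl) (simp add: Atl_Minus fin)
  then have "binner (slots G i) (Atl G i v) (\<lambda>s. y s - x s) =
      (\<Sum>j\<in>nbrs G i. v j \<bullet> (y P - x P)) + (\<Sum>j\<in>nbrs G i. - v j \<bullet> (y (Minus j) - x (Minus j)))"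
    by (simp add: binner_def sum_slots fin Atl_P Atl_Plus inner_sum_left)
  then show ?thesis
    unfolding Az by (simp add: inner_diff_right sum_subtractf sum_negf)
qed

text \<open>The Lagrangian lies above its linearisation at \<open>z\<close>, whose increments on \<open>\<X> \<inter> \<Z>\<close> are
  nonnegative by the variational inequality; this makes \<open>z\<close> a minimiser.  The gradient with respect
  to \<open>u\<^sub>i\<close> is \<open>- D\<^sub>i Q\<^sub>i z\<^sub>i\<close>, so the condition on \<open>u\<close> is the normality hypothesis itself.\<close>

lemma KKT_P_if_stationary:
  assumes G: "pair_graph G" and z: "z \<in> Xset \<A> a \<inter> Zset G"
    and vi: "\<And>w. w \<in> Xset \<A> a \<inter> Zset G \<Longrightarrow> 0 \<le> (\<Sum>i\<in>pverts G.
      binner (slots G i) (\<lambda>s. F_zgrad G d i (z i) (u i) s + Atl G i (l i) s) (\<lambda>s. w i s - z i s))"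
    and u: "\<And>i. i \<in> pverts G \<Longrightarrow> u i \<in> ball_prod (nbrs G i)"
    and normal: "\<And>i w. i \<in> pverts G \<Longrightarrow> w \<in> ball_prod (nbrs G i) \<Longrightarrow>
      binner (nbrs G i) (\<lambda>j. d i j *\<^sub>R (z i P - z i (Plus j))) (\<lambda>j. w j - u i j) \<le> 0"
    and feasible: "\<And>i j. i \<in> pverts G \<Longrightarrow> j \<in> nbrs G i \<Longrightarrow> Az G i (z i) j = 0"
  shows "KKT_P G \<A> a d z u l"
proof -
  note nb = pair_graph_nbrs[OF G]
  let ?L = "\<lambda>y. \<Sum>i\<in>pverts G. Fobj G d i (y i) (u i) + binner (nbrs G i) (l i) (Az G i (y i))"
  have "?L z \<le> ?L y" if "y \<in> Xset \<A> a \<inter> Zset G" for y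
  proof -
    let ?D = "\<lambda>i. binner (slots G i) (\<lambda>s. F_zgrad G d i (z i) (u i) s + Atl G i (l i) s)
      (\<lambda>s. y i s - z i s)"
    have "?D i \<le> (Fobj G d i (y i) (u i) + binner (nbrs G i) (l i) (Az G i (y i)))
        - (Fobj G d i (z i) (u i) + binner (nbrs G i) (l i) (Az G i (z i)))" for i
      using Fobj_expansion[OF nb(2), of d i "y i" "u i" "z i"]
        binner_Az_diff[OF nb(2), of i "l i" "y i" "z i"]
      by (simp add: binner_def inner_add_left sum.distrib)
    then have "(\<Sum>i\<in>pverts G. ?D i) \<le> (\<Sum>i\<in>pverts G.
        (Fobj G d i (y i) (u i) + binner (nbrs G i) (l i) (Az G i (y i)))
        - (Fobj G d i (z i) (u i) + binner (nbrs G i) (l i) (Az G i (z i))))"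
      by (intro sum_mono)
    then show ?thesis
      using vi[OF that] by (simp add: sum_subtractf)
  qed
  then have "is_arg_min ?L (\<lambda>y. y \<in> Xset \<A> a \<inter> Zset G) z"
    using z by (auto simp: is_arg_min_def not_less)
  moreover have "\<exists>g\<in>bsubdiff (nbrs G i) (indic (ball_prod (nbrs G i))) (u i).
      \<forall>j\<in>nbrs G i. 0 = bgrad (Fobj G d i (z i)) (u i) j + g j" if "i \<in> pverts G" for i
  proof (intro bexI ballI)
    show "0 = bgrad (Fobj G d i (z i)) (u i) j + d i j *\<^sub>R (z i P - z i (Plus j))"
      if "j \<in> nbrs G i" for j
      by (simp add: bgrad_Fobj_u[OF nb(2) that])
    show "(\<lambda>j. d i j *\<^sub>R (z i P - z i (Plus j))) \<in> bsubdiff (nbrs G i) (indic (ball_prod (nbrs G i))) (u i)"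
      using u normal that by (auto simp: bsubdiff_def indic_def)
  qed
  ultimately show ?thesis
    using feasible by (simp add: KKT_P_def)
qed

text \<open>Feasibility and \<open>\<Z>\<close> together make every copy \<open>z\<^sub>i\<^sub>j\<^sup>+ = z\<^sub>j\<^sub>i\<^sup>-\<close> equal to \<open>p\<^sub>j\<close>.  The gradient of
  the Lagrangian is \<open>- \<lambda>\<^sub>j\<^sub>i\<close> at the slot \<open>Minus i\<close> of \<open>j\<close> and \<open>- v\<^sub>i\<^sub>j\<close> at the slot \<open>Plus j\<close> of
  \<open>i\<close>; these cancel, so the multipliers can be eliminated from the equation at the position
  \<open>p\<^sub>i\<close>.\<close>

lemma critical_S_if_stationary:
  assumes G: "pair_graph G" and z: "z \<in> Xset \<A> a \<inter> Zset G"
    and vi: "\<And>w. w \<in> Xset \<A> a \<inter> Zset G \<Longrightarrow> 0 \<le> (\<Sum>i\<in>pverts G.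
      binner (slots G i) (\<lambda>s. F_zgrad G d i (z i) (u i) s + Atl G i (l i) s) (\<lambda>s. w i s - z i s))"
    and u: "\<And>i. i \<in> pverts G \<Longrightarrow> u i \<in> ball_prod (nbrs G i)"
    and normal: "\<And>i w. i \<in> pverts G \<Longrightarrow> w \<in> ball_prod (nbrs G i) \<Longrightarrow>
      binner (nbrs G i) (\<lambda>j. d i j *\<^sub>R (z i P - z i (Plus j))) (\<lambda>j. w j - u i j) \<le> 0"
    and feasible: "\<And>i j. i \<in> pverts G \<Longrightarrow> j \<in> nbrs G i \<Longrightarrow> Az G i (z i) j = 0"
  shows "critical_S G \<A> a d (\<lambda>i. z i P) u"
  unfolding critical_S_def
proof (intro conjI ballI)
  note nb = pair_graph_nbrs[OF G]
  show "z j P = a j" if "j \<in> \<A>" for j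
    using z that by (simp add: Xset_def)
  have plus: "z i (Plus j) = z j P" if "j \<in> nbrs G i" for i j
  proof -
    have "z i (Plus j) = z j (Minus i)"
      using z nb(3)[OF that] that by (simp add: Zset_def)
    moreover have "z j P - z j (Minus i) = 0"
      using feasible[of j i] Az_eq[OF nb(2), of i j "z j"] nb(4,5) that by auto
    ultimately show ?thesis
      by simp
  qed
  define v where "v i j = z i P - z j P - d i j *\<^sub>R u i j" for i j
  have multiplier: "l i j = - v j i" if "j \<in> nbrs G i" for i j
  proof -
    have i: "j \<in> pverts G" "i \<in> nbrs G j"
      using that nb(4,5) by auto
    show ?thesis
      using XZ_stationary(2)[OF G z vi i] that i(2)
      by (simp add: Atl_Plus[OF nb(2)] Atl_Minus[OF nb(2)] plus v_def)
  qed
  show "0 = (\<Sum>j\<in>nbrs G i. z i P - z j P - d i j *\<^sub>R u i j + z i P - z j P + d j i *\<^sub>R u j i)"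
    if i: "i \<in> pverts G - \<A>" for i
  proof -
    have "0 = (\<Sum>j\<in>nbrs G i. v i j) + (\<Sum>j\<in>nbrs G i. l i j)"
      using XZ_stationary(1)[OF G z vi i] by (simp add: Atl_P[OF nb(2)] plus v_def)
    also have "\<dots> = (\<Sum>j\<in>nbrs G i. v i j - v j i)"
      by (simp add: multiplier sum_subtractf sum_negf)
    also have "\<dots> = (\<Sum>j\<in>nbrs G i. z i P - z j P - d i j *\<^sub>R u i j + z i P - z j P + d j i *\<^sub>R u j i)"
      by (simp add: v_def algebra_simps)
    finally show ?thesis .
  qed
  show "\<exists>g\<in>subdiff (indic (cball 0 1)) (u i j). 0 = - d i j *\<^sub>R (z i P - z j P) + g"
    if i: "i \<in> pverts G" and j: "j \<in> nbrs G i" for i j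
  proof (intro bexI)
    show "d i j *\<^sub>R (z i P - z j P) \<in> subdiff (indic (cball 0 1)) (u i j)"
      unfolding mem_subdiff_indic_iff[of "cball 0 1", simplified]
    proof (intro conjI ballI)
      have ui: "\<forall>k\<in>nbrs G i. u i k \<in> cball 0 1"
        using u[OF i] by (simp add: ball_prod_def)
      then show "norm (u i j) \<le> 1"
        using j by simp
      \<comment> \<open>the product of balls is tested in one factor only\<close>
      fix y :: "real ^ 'a" assume y: "y \<in> cball 0 1"
      then have "(u i)(j := y) \<in> ball_prod (nbrs G i)"
        using ui by (simp add: ball_prod_def)
      from normal[OF i this] show "d i j *\<^sub>R (z i P - z j P) \<bullet> (y - u i j) \<le> 0"
        unfolding binner_fun_upd[OF nb(2) j] plus[OF j] .
    qed
  qed simp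
qed

theorem lemma3:
  fixes G :: "nat pair_pre_digraph"
    and N m :: nat
    and a :: "nat \<Rightarrow> real ^ 'n"
    and d :: "nat \<Rightarrow> nat \<Rightarrow> real"
    and c \<rho> :: real
    and r :: "nat \<Rightarrow> nat"
    and B :: "nat \<Rightarrow> nat \<Rightarrow> slot \<times> 'n \<Rightarrow> real"
    and z :: "nat \<Rightarrow> nat \<Rightarrow> slot \<Rightarrow> real ^ 'n"
    and u l :: "nat \<Rightarrow> nat \<Rightarrow> nat \<Rightarrow> real ^ 'n"
    and t :: nat
  defines "\<A> \<equiv> {N - m + 1..N}"
  assumes "pair_graph G" and "Digraph_Component.connected (with_proj G)"
    and "pverts G = {1..N}"
    and "1 \<le> m" and "m \<le> N"
    and "\<And>i j. (i, j) \<in> parcs G \<Longrightarrow> d i j = d j i"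
    and "0 < c" and "0 < \<rho>"
    and "B_choice G c r B"
    and "sp_admm G \<A> a d c \<rho> r B z u l"
    and "1 \<le> t"
    and "opt_gap G \<A> a d (z t) (u t) (u (t - 1)) (l t) = 0"
  shows "KKT_P G \<A> a d (z t) (u t) (l t) \<and>
    critical_S G \<A> a d (\<lambda>i. z t i P) (u t) \<and>
    ((\<forall>i j. (i, j) \<in> parcs G \<longrightarrow> 0 \<le> d i j) \<longrightarrow> critical_O G \<A> a d (\<lambda>i. z t i P))"
proof -
  note G = assms(2) and admm = assms(11) and gap = assms(13)
  note nb = pair_graph_nbrs[OF G]
  have fin_slots: "finite (slots G i)" for i
    using nb by (simp add: slots_def)
  have \<A>: "\<A> \<subseteq> pverts G"
    using assms(4) by (auto simp: \<A>_def)
  define g where "g k q = bgrad (\<lambda>y. Fobj G d k y (u t k)) (z t k) q + Atl G k (l t k) q" for k q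
  define Z where "Z i = (\<lambda>s. z t i s - proj_XZ G \<A> a (\<lambda>k q. z t k q - g k q) i s)" for i
  have "(\<Sum>i\<in>pverts G. (bnorm (slots G i) (Z i))\<^sup>2 + (bnorm (nbrs G i) (Az G i (z t i)))\<^sup>2
      + (bnorm (nbrs G i) (\<lambda>j. u t i j - u (t - 1) i j))\<^sup>2) = 0"
    using gap by (simp add: opt_gap_def g_def Z_def)
  then have gap_terms: "bnorm (slots G i) (Z i) = 0 \<and> bnorm (nbrs G i) (Az G i (z t i)) = 0
      \<and> bnorm (nbrs G i) (\<lambda>j. u t i j - u (t - 1) i j) = 0" if "i \<in> pverts G" for i
    using that by (simp add: sum_nonneg_eq_0_iff nb add_nonneg_eq_0_iff)
  have z_fixed: "proj_XZ G \<A> a (\<lambda>k q. z t k q - g k q) i s = z t i s"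
    if "i \<in> pverts G" "s \<in> slots G i" for i s
    using gap_terms[OF that(1)] that(2) by (simp add: bnorm_eq_0_iff fin_slots Z_def)
  have feasible: "Az G i (z t i) j = 0" and u_same: "u (t - 1) i j = u t i j"
    if "i \<in> pverts G" "j \<in> nbrs G i" for i j
    using gap_terms[OF that(1)] that(2) by (simp_all add: bnorm_eq_0_iff nb)
  have z: "z t \<in> Xset \<A> a \<inter> Zset G"
    by (rule proj_XZ_fixed_point(1)[OF G \<A> z_fixed])
  have vi: "0 \<le> (\<Sum>i\<in>pverts G. binner (slots G i)
      (\<lambda>s. F_zgrad G d i (z t i) (u t i) s + Atl G i (l t i) s) (\<lambda>s. w i s - z t i s))"
    if "w \<in> Xset \<A> a \<inter> Zset G" for w
  proof -
    have "0 \<le> (\<Sum>i\<in>pverts G. binner (slots G i) (g i) (\<lambda>s. w i s - z t i s))"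
      by (rule proj_XZ_fixed_point(2)[OF G \<A> z_fixed that])
    then show ?thesis
      by (simp add: binner_def g_def bgrad_Fobj_z nb)
  qed
  let ?q = "\<lambda>i j. d i j *\<^sub>R (z t i P - z t i (Plus j))"
  have u_fixed: "bproj (nbrs G i) (ball_prod (nbrs G i)) (\<lambda>k. u t i k + (1 / \<rho>) *\<^sub>R ?q i k) j = u t i j"
    if i: "i \<in> pverts G" and j: "j \<in> nbrs G i" for i j
  proof -
    let ?v = "mvec (nbrs G i) (Dmat d i) (Qz G i (z t i))"
    have "u (Suc (t - 1)) i j = bproj (nbrs G i) (ball_prod (nbrs G i))
        (\<lambda>k. u (t - 1) i k + (1 / \<rho>) *\<^sub>R
          mvec (nbrs G i) (Dmat d i) (Qz G i (z (Suc (t - 1)) i)) k) j"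
      using admm i j unfolding sp_admm_def by blast
    then have "u t i j = bproj (nbrs G i) (ball_prod (nbrs G i))
        (\<lambda>k. u (t - 1) i k + (1 / \<rho>) *\<^sub>R ?v k) j"
      using \<open>1 \<le> t\<close> by simp
    also have "\<dots> = bproj (nbrs G i) (ball_prod (nbrs G i)) (\<lambda>k. u t i k + (1 / \<rho>) *\<^sub>R ?q i k) j"
      using i by (intro fun_cong[OF bproj_cong]) (simp add: u_same[unfolded One_nat_def] Dmat_mvec_eq Qz_eq nb)
    finally show ?thesis ..
  qed
  have u: "u t i \<in> ball_prod (nbrs G i)" if "i \<in> pverts G" for i
    using bproj_ball_prod_fixed_point(1)[OF _ u_fixed[OF that]] \<open>0 < \<rho>\<close> by simp
  have normal: "binner (nbrs G i) (?q i) (\<lambda>j. w j - u t i j) \<le> 0"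
    if "i \<in> pverts G" "w \<in> ball_prod (nbrs G i)" for i w
    using bproj_ball_prod_fixed_point(2)[OF _ u_fixed[OF that(1)] that(2)] \<open>0 < \<rho>\<close> by simp
  have S: "critical_S G \<A> a d (\<lambda>i. z t i P) (u t)"
    by (rule critical_S_if_stationary[OF G z vi u normal feasible])
  show ?thesis
    using KKT_P_if_stationary[OF G z vi u normal feasible] S
      critical_S_imp_critical_O[OF G assms(7) _ S] by blast
qed

end
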